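(* Let $n\ge 2$, and let $f,g\in\mathbb{C}[z_1,\ldots,z_n]$ be weighted homogeneous polynomials with weights $w_f$ and $w_g$, respectively. Suppose that there exists a positive rational number $s$ such that $w_g=s\,w_f$. Then, for every sufficiently small $\varepsilon>0$, a point $p\in S_\varepsilon\setminus K_{fg}$ is a singular point of the Milnor fibration product map $\Phi:S_\varepsilon\setminus K_{fg}\to T^2$ associated with $f$ and $g$ if and only if $$\frac{\partial f}{\partial z_j}(p)\frac{\partial g}{\partial z_k}(p)-\frac{\partial f}{\partial z_k}(p)\frac{\partial g}{\partial z_j}(p)=0$$ holds for all $j,k=1,2,\ldots,n$.
   Context: Weighted homogeneous: $f\in\mathbb{C}[z_1,\ldots,z_n]$ is weighted homogeneous with weights $w_f=(w_1,\ldots,w_n)$, a sequence of positive rational numbers, if $\sum_{j=1}^n \frac{z_j}{w_j}\frac{\partial f}{\partial z_j}=f$. The equation $w_g=s w_f$ means each weight of $g$ is $s$ times the corresponding weight of $f$. $S_\varepsilon=\{z\in\mathbb{C}^n\mid \|z\|=\varepsilon\}$ and $K_{fg}=\{z\in S_\varepsilon\mid f(z)g(z)=0\}$. The Milnor fibration product map associated with $f,g$ is the $C^\infty$ map $\Phi:S_\varepsilon\setminus K_{fg}\to S^1\times S^1=T^2$, $\Phi(z)=\left(\frac{f(z)}{|f(z)|},\frac{g(z)}{|g(z)|}\right)$. A point $p$ is a singular point of $\Phi$ if $\mathrm{rank}\,d\Phi_p<2$. "For every sufficiently small $\varepsilon>0$" means: there is $\varepsilon_0>0$ (depending on $f,g$)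 such that the assertion holds for all $0<\varepsilon\le\varepsilon_0$. *)

theory Defs
  imports "HOL-Analysis.Analysis" "HOL-Library.Poly_Mapping"
begin

text \<open>
  The variables \<open>z\<^sub>1, \<dots>, z\<^sub>n\<close> are indexed by a finite type \<open>'n\<close>, so that \<open>n = CARD('n)\<close> and
  the ambient space is \<open>complex ^ 'n\<close>. An element of \<open>\<complex>[z\<^sub>1, \<dots>, z\<^sub>n]\<close> is a finitely supported map from
  exponent vectors to coefficients; addition and multiplication are those of \<open>Poly_Mapping\<close>.
\<close>

type_synonym 'n cpoly = "('n \<Rightarrow>\<^sub>0 nat) \<Rightarrow>\<^sub>0 complex"

definition cpoly_const :: "complex \<Rightarrow> 'n cpoly" where
  "cpoly_const c = Poly_Mapping.single 0 c"

definition cpoly_var :: "'n \<Rightarrow> 'n cpoly" where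
  "cpoly_var j = Poly_Mapping.single (Poly_Mapping.single j 1) 1"

definition cpoly_eval :: "'n::finite cpoly \<Rightarrow> complex ^ 'n \<Rightarrow> complex" where
  "cpoly_eval f z =
     (\<Sum>m\<in>Poly_Mapping.keys f.
        Poly_Mapping.lookup f m * (\<Prod>i\<in>UNIV. z $ i ^ Poly_Mapping.lookup m i))"

text \<open>
  Below, the exponent \<open>m - single j 1\<close> is truncated if \<open>z\<^sub>j\<close> does not occur in \<open>m\<close>, but then the
  coefficient is \<open>0\<close>.
\<close>

definition cpoly_partial :: "'n \<Rightarrow> 'n cpoly \<Rightarrow> 'n cpoly" where
  "cpoly_partial j f =
     (\<Sum>m\<in>Poly_Mapping.keys f.
        Poly_Mapping.single (m - Poly_Mapping.single j 1)
          (of_nat (Poly_Mapping.lookup m j) * Poly_Mapping.lookup f m))"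

definition weighted_homogeneous :: "('n::finite \<Rightarrow> rat) \<Rightarrow> 'n cpoly \<Rightarrow> bool" where
  "weighted_homogeneous w f \<longleftrightarrow>
     (\<forall>j. 0 < w j) \<and>
     (\<Sum>j\<in>UNIV. cpoly_const (1 / of_rat (w j)) * cpoly_var j * cpoly_partial j f) = f"

definition milnor_link :: "'n::finite cpoly \<Rightarrow> 'n cpoly \<Rightarrow> real \<Rightarrow> (complex ^ 'n) set" where
  "milnor_link f g \<epsilon> = {z \<in> sphere 0 \<epsilon>. cpoly_eval f z * cpoly_eval g z = 0}"

text \<open>The torus \<open>T\<^sup>2\<close> is regarded as a submanifold of \<open>\<complex> \<times> \<complex>\<close>.\<close>

definition milnor_product_map ::
    "'n::finite cpoly \<Rightarrow> 'n cpoly \<Rightarrow> complex ^ 'n \<Rightarrow> complex \<times> complex" where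
  "milnor_product_map f g z =
     (cpoly_eval f z / of_real (cmod (cpoly_eval f z)),
      cpoly_eval g z / of_real (cmod (cpoly_eval g z)))"

text \<open>Velocity vectors at \<open>p\<close> of curves in \<open>M\<close>; this is used only for submanifolds \<open>M\<close>.\<close>

definition tangent_space :: "'a::real_normed_vector set \<Rightarrow> 'a \<Rightarrow> 'a set" where
  "tangent_space M p =
     {v. \<exists>\<gamma>. \<gamma> 0 = p \<and> (\<forall>\<^sub>F t in nhds (0::real). \<gamma> t \<in> M) \<and>
             (\<gamma> has_vector_derivative v) (at 0)}"

text \<open>
  The real rank of the differential of \<open>\<Phi>\<close>, a differentiable map on a submanifold \<open>M\<close>, at \<open>p\<close>.
  The Frechet derivative within \<open>M\<close> is not unique on the whole ambient space, but its restriction to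
  the tangent space is, and only that restriction is used.
\<close>

definition differential_rank ::
    "'a::real_normed_vector set \<Rightarrow> ('a \<Rightarrow> 'b::real_normed_vector) \<Rightarrow> 'a \<Rightarrow> nat" where
  "differential_rank M \<Phi> p = dim (frechet_derivative \<Phi> (at p within M) ` tangent_space M p)"

definition milnor_singular_point ::
    "'n::finite cpoly \<Rightarrow> 'n cpoly \<Rightarrow> real \<Rightarrow> complex ^ 'n \<Rightarrow> bool" where
  "milnor_singular_point f g \<epsilon> p \<longleftrightarrow>
     differential_rank (sphere 0 \<epsilon> - milnor_link f g \<epsilon>) (milnor_product_map f g) p < 2"

end

theory Submission
  imports Defs
begin

text \<open>
  Write \<open>A = df\<^sub>p / f(p)\<close> and \<open>B = dg\<^sub>p / g(p)\<close>. In suitable coordinates \<open>d\<Phi>\<^sub>p\<close> is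
  \<open>v \<mapsto> (Im (A v), Im (B v))\<close> on the real orthogonal complement of \<open>p\<close>, so \<open>p\<close> is singular iff
  \<open>Im (a A + b B)\<close> vanishes on this complement for some real \<open>(a, b) \<noteq> 0\<close>, i.e. iff it equals
  \<open>c Re \<langle>p, \<cdot>\<rangle>\<close> for some real \<open>c\<close>. The Euler vector \<open>E = (p\<^sub>j / w\<^sub>j)\<close> satisfies \<open>A E = 1\<close> and
  \<open>B E = s\<close>. Evaluating at \<open>\<i>E\<close>, which is tangent to the sphere, gives \<open>a + b s = 0\<close>; evaluating at
  \<open>E\<close>, which is not, then gives \<open>c = 0\<close>. Hence \<open>B = s A\<close>, and conversely proportionality of \<open>A\<close> and
  \<open>B\<close> forces \<open>B = s A\<close> by evaluation at \<open>E\<close>.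
\<close>

section \<open>Evaluation of polynomials\<close>

lemma cpoly_eval_0 [simp]: "cpoly_eval 0 z = 0"
  by (simp add: cpoly_eval_def)

lemma cpoly_eval_single:
  "cpoly_eval (Poly_Mapping.single m c) z = c * (\<Prod>i\<in>UNIV. z $ i ^ Poly_Mapping.lookup m i)"
  by (simp add: cpoly_eval_def)

lemma cpoly_eval_add: "cpoly_eval (f + g) z = cpoly_eval f z + cpoly_eval g z"
  unfolding cpoly_eval_def
  by (rule setsum_keys_plus_distrib) (simp_all add: algebra_simps)

lemma cpoly_eval_sum: "cpoly_eval (\<Sum>x\<in>A. f x) z = (\<Sum>x\<in>A. cpoly_eval (f x) z)"
  by (induction A rule: infinite_finite_induct) (simp_all add: cpoly_eval_add)

lemma sum_monomials: "(\<Sum>m\<in>Poly_Mapping.keys f. Poly_Mapping.single m (Poly_Mapping.lookup f m)) = f"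
  by (rule poly_mapping_eqI)
    (auto simp: lookup_sum lookup_single when_def in_keys_iff)

text \<open>Multiplication by a monomial translates the exponents and scales the coefficients. A
  monomial left factor suffices for the terms of the Euler identity.\<close>

lemma cpoly_eval_single_mult:
  "cpoly_eval (Poly_Mapping.single m c * f) z = cpoly_eval (Poly_Mapping.single m c) z * cpoly_eval f z"
proof -
  have "Poly_Mapping.single m c * f =
      (\<Sum>k\<in>Poly_Mapping.keys f. Poly_Mapping.single (m + k) (c * Poly_Mapping.lookup f k))"
    by (subst (1) sum_monomials [of f, symmetric]) (simp add: sum_distrib_left mult_single)
  then show ?thesis
    by (simp add: cpoly_eval_sum cpoly_eval_single lookup_add power_add prod.distrib
        cpoly_eval_def [of f] sum_distrib_left mult_ac)
qed

lemma cpoly_eval_euler_term: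
  "cpoly_eval (cpoly_const c * cpoly_var j * f) z = c * z $ j * cpoly_eval f z"
proof -
  have "(\<Prod>i\<in>UNIV. z $ i ^ Poly_Mapping.lookup (Poly_Mapping.single j 1) i) = z $ j"
    by (subst prod.remove [of _ j]) (auto simp: lookup_single when_def intro!: prod.neutral)
  then show ?thesis
    by (simp add: cpoly_const_def cpoly_var_def mult_single cpoly_eval_single_mult cpoly_eval_single)
qed

text \<open>Passes from the formal polynomial identity to values; at \<open>p\<close> it gives the
  values of \<open>df\<close> and \<open>dg\<close> on the Euler vector.\<close>

lemma weighted_homogeneous_euler:
  assumes "weighted_homogeneous w f"
  shows "(\<Sum>j\<in>UNIV. z $ j / of_rat (w j) * cpoly_eval (cpoly_partial j f) z) = cpoly_eval f z"
proof -
  have "cpoly_eval f z =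
      cpoly_eval (\<Sum>j\<in>UNIV. cpoly_const (1 / of_rat (w j)) * cpoly_var j * cpoly_partial j f) z"
    using assms by (simp add: weighted_homogeneous_def)
  then show ?thesis
    by (simp add: cpoly_eval_sum cpoly_eval_euler_term)
qed

definition cpoly_diff :: "'n::finite cpoly \<Rightarrow> complex ^ 'n \<Rightarrow> complex ^ 'n \<Rightarrow> complex" where
  "cpoly_diff f z v = (\<Sum>j\<in>UNIV. v $ j * cpoly_eval (cpoly_partial j f) z)"

text \<open>Truncated subtraction occurs on both sides, so the identity also holds when the exponent
  of \<open>j\<close> in \<open>m\<close> is 0. The right side has the shape produced by the product
  and power rules.\<close>

lemma prod_lookup_diff_single:
  fixes z :: "complex ^ 'n::finite"
  shows "(\<Prod>i\<in>UNIV. z $ i ^ Poly_Mapping.lookup (m - Poly_Mapping.single j 1) i) =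
    z $ j ^ (Poly_Mapping.lookup m j - 1) * (\<Prod>i\<in>UNIV - {j}. z $ i ^ Poly_Mapping.lookup m i)"
  by (subst prod.remove [of _ j])
    (auto simp: lookup_minus lookup_single when_def intro!: prod.cong)

lemma cpoly_eval_has_derivative:
  "(cpoly_eval f has_derivative cpoly_diff f z) (at z)"
proof -
  have comp: "((\<lambda>z. z $ i) has_derivative (\<lambda>v. v $ i)) (at z)" for i
    by (rule bounded_linear_imp_has_derivative) (rule bounded_linear_vec_nth)
  have "((\<lambda>z. \<Sum>m\<in>Poly_Mapping.keys f.
        Poly_Mapping.lookup f m * (\<Prod>i\<in>UNIV. z $ i ^ Poly_Mapping.lookup m i)) has_derivative
      (\<lambda>v. \<Sum>m\<in>Poly_Mapping.keys f. Poly_Mapping.lookup f m *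
        (\<Sum>i\<in>UNIV. of_nat (Poly_Mapping.lookup m i) * v $ i * z $ i ^ (Poly_Mapping.lookup m i - 1) *
           (\<Prod>j\<in>UNIV - {i}. z $ j ^ Poly_Mapping.lookup m j)))) (at z)"
    by (intro has_derivative_sum has_derivative_mult_right has_derivative_prod has_derivative_power comp)
  \<comment> \<open>The product rule groups terms by monomial, \<open>cpoly_diff\<close> by
    variable; interchanging the two sums matches them.\<close>
  moreover have "(\<Sum>m\<in>Poly_Mapping.keys f. Poly_Mapping.lookup f m *
        (\<Sum>i\<in>UNIV. of_nat (Poly_Mapping.lookup m i) * v $ i * z $ i ^ (Poly_Mapping.lookup m i - 1) *
           (\<Prod>j\<in>UNIV - {i}. z $ j ^ Poly_Mapping.lookup m j))) = cpoly_diff f z v" for v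
    unfolding cpoly_diff_def cpoly_partial_def cpoly_eval_sum cpoly_eval_single
      prod_lookup_diff_single sum_distrib_left
    by (subst sum.swap) (simp add: mult_ac)
  ultimately show ?thesis
    by (simp add: cpoly_eval_def [abs_def])
qed

lemma linear_cpoly_diff: "linear (cpoly_diff f z)"
  using cpoly_eval_has_derivative by (rule has_derivative_linear)

lemma cpoly_diff_mult_left: "cpoly_diff f z (\<chi> j. c * v $ j) = c * cpoly_diff f z v"
  by (simp add: cpoly_diff_def sum_distrib_left mult_ac)

lemma cpoly_diff_axis: "cpoly_diff f z (axis j c) = c * cpoly_eval (cpoly_partial j f) z"
  unfolding cpoly_diff_def by (subst sum.remove [of _ j]) (auto simp: axis_def)

section \<open>Tangent vectors and the rank of a differential\<close>

text \<open>By the chain rule, any derivative within \<open>M\<close> sends \<open>v\<close> to the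
  velocity of \<open>\<Phi> \<circ> \<gamma>\<close>, and derivatives in one real variable are
  unique. Hence the derivative chosen by \<open>frechet_derivative\<close> agrees with
  \<open>D\<close> on tangent vectors.\<close>

lemma frechet_derivative_within_tangent:
  assumes \<Phi>: "(\<Phi> has_derivative D) (at p within M)" and v: "v \<in> tangent_space M p"
  shows "frechet_derivative \<Phi> (at p within M) v = D v"
proof -
  obtain \<gamma> where \<gamma>: "\<gamma> 0 = p" "\<forall>\<^sub>F t in nhds (0::real). \<gamma> t \<in> M"
      "(\<gamma> has_vector_derivative v) (at 0)"
    using v by (auto simp: tangent_space_def)
  obtain S where S: "open S" "0 \<in> S" "\<And>t. t \<in> S \<Longrightarrow> \<gamma> t \<in> M"
    using \<gamma>(2) unfolding eventually_nhds by blast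
  have deriv: "((\<Phi> \<circ> \<gamma>) has_vector_derivative D' v) (at 0)"
    if D': "(\<Phi> has_derivative D') (at p within M)" for D'
  proof -
    have "(\<gamma> has_derivative (\<lambda>t. t *\<^sub>R v)) (at 0 within S)"
      using \<gamma>(3) has_derivative_at_withinI by (auto simp: has_vector_derivative_def)
    moreover have "(\<Phi> has_derivative D') (at (\<gamma> 0) within \<gamma> ` S)"
      using D' S(3) \<gamma>(1) by (auto intro: has_derivative_subset)
    ultimately have "((\<Phi> \<circ> \<gamma>) has_derivative (D' \<circ> (\<lambda>t. t *\<^sub>R v))) (at 0 within S)"
      by (rule diff_chain_within)
    then have "((\<Phi> \<circ> \<gamma>) has_derivative (D' \<circ> (\<lambda>t. t *\<^sub>R v))) (at 0)"
      using at_within_open [OF S(2,1)] by metis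
    then show ?thesis
      unfolding has_vector_derivative_def o_def linear_scale [OF has_derivative_linear [OF D']] .
  qed
  have "(\<Phi> has_derivative frechet_derivative \<Phi> (at p within M)) (at p within M)"
    using \<Phi> by (metis differentiableI frechet_derivative_works)
  then show ?thesis
    using deriv \<Phi> vector_derivative_unique_at by blast
qed

lemma differential_rank_eq:
  assumes "(\<Phi> has_derivative D) (at p within M)"
  shows "differential_rank M \<Phi> p = dim (D ` tangent_space M p)"
  unfolding differential_rank_def
  by (rule arg_cong [where f = dim], rule image_cong)
    (simp_all add: frechet_derivative_within_tangent [OF assms])

lemma tangent_space_sphere_Int_open:
  fixes p :: "'a::real_inner"
  assumes p: "p \<in> sphere 0 r" "0 < r" and U: "open U" "p \<in> U"
  shows "tangent_space (sphere 0 r \<inter> U) p = {v. p \<bullet> v = 0}"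
proof (intro equalityI subsetI CollectI)
  fix v assume "v \<in> tangent_space (sphere 0 r \<inter> U) p"
  then obtain \<gamma> where \<gamma>: "\<gamma> 0 = p" "\<forall>\<^sub>F t in nhds (0::real). \<gamma> t \<in> sphere 0 r \<inter> U"
      "(\<gamma> has_vector_derivative v) (at 0)"
    by (auto simp: tangent_space_def)
  \<comment> \<open>Along the curve the squared norm is constantly \<open>r\<^sup>2\<close>;
    computing its derivative in two ways gives orthogonality.\<close>
  have "((\<lambda>t. \<gamma> t \<bullet> \<gamma> t) has_derivative (\<lambda>t. \<gamma> 0 \<bullet> (t *\<^sub>R v) + (t *\<^sub>R v) \<bullet> \<gamma> 0)) (at 0)"
    using \<gamma>(3) unfolding has_vector_derivative_def by (intro has_derivative_inner)
  then have "((\<lambda>t. \<gamma> t \<bullet> \<gamma> t) has_vector_derivative 2 * (p \<bullet> v)) (at 0)"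
    by (simp add: has_vector_derivative_def \<gamma>(1) inner_commute algebra_simps)
  moreover have "((\<lambda>t. \<gamma> t \<bullet> \<gamma> t) has_vector_derivative 0) (at 0)"
  proof -
    have "\<forall>\<^sub>F t in nhds 0. r\<^sup>2 = \<gamma> t \<bullet> \<gamma> t"
      using \<gamma>(2) by eventually_elim (simp add: dot_square_norm)
    then obtain S where S: "open S" "0 \<in> S" "\<And>t. t \<in> S \<Longrightarrow> r\<^sup>2 = \<gamma> t \<bullet> \<gamma> t"
      unfolding eventually_nhds by blast
    show ?thesis
      by (rule has_vector_derivative_transform_within_open [OF has_vector_derivative_const S])
  qed
  ultimately have "2 * (p \<bullet> v) = 0"
    by (rule vector_derivative_unique_at)
  then show "p \<bullet> v = 0"
    by simp
next
  fix v assume "v \<in> {v. p \<bullet> v = 0}"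
  then have v: "p \<bullet> v = 0" "v \<bullet> p = 0"
    by (simp_all add: inner_commute)
  \<comment> \<open>Radial projection of the line \<open>p + t v\<close> to the sphere. Since
    \<open>v\<close> is orthogonal to \<open>p\<close>, the norm is stationary at
    \<open>t = 0\<close>, so the rescaling leaves the velocity \<open>v\<close> unchanged.\<close>
  define \<gamma> where "\<gamma> t = (r / norm (p + t *\<^sub>R v)) *\<^sub>R (p + t *\<^sub>R v)" for t
  have normp: "norm p = r"
    using p by simp
  have nz: "p + t *\<^sub>R v \<noteq> 0" for t
  proof
    assume "p + t *\<^sub>R v = 0"
    then have "p \<bullet> (p + t *\<^sub>R v) = 0" by simp
    then show False using p(2) normp v(1) by (simp add: inner_add_right)
  qed
  have "((\<lambda>t. norm (p + t *\<^sub>R v)) has_derivative (\<lambda>t. sgn p \<bullet> (t *\<^sub>R v))) (at 0)"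
  proof -
    have "((\<lambda>t. p + t *\<^sub>R v) has_derivative (\<lambda>t. t *\<^sub>R v)) (at 0)"
      by (auto intro!: derivative_eq_intros)
    moreover have "(norm has_derivative (\<lambda>h. sgn p \<bullet> h)) (at (p + 0 *\<^sub>R v))"
      using has_derivative_norm [of p] nz [of 0] by (simp add: inner_commute)
    ultimately show ?thesis
      by (rule has_derivative_compose)
  qed
  then have "((\<lambda>t. norm (p + t *\<^sub>R v)) has_vector_derivative 0) (at 0)"
    by (simp add: has_vector_derivative_def sgn_div_norm v)
  then have norm_deriv: "((\<lambda>t. norm (p + t *\<^sub>R v)) has_field_derivative 0) (at 0)"
    by (simp add: has_real_derivative_iff_has_vector_derivative)
  have "(\<gamma> has_vector_derivative v) (at 0)"
  proof -
    have "((\<lambda>t. p + t *\<^sub>R v) has_vector_derivative v) (at 0)"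
      by (auto simp: has_vector_derivative_def intro!: derivative_eq_intros)
    moreover have "((\<lambda>t. r / norm (p + t *\<^sub>R v)) has_field_derivative 0) (at 0)"
      using DERIV_divide [OF DERIV_const norm_deriv, of r] nz [of 0] by simp
    ultimately show ?thesis
      using has_vector_derivative_scaleR p(2) normp by (fastforce simp: \<gamma>_def [abs_def])
  qed
  moreover have "\<gamma> 0 = p"
    using p(2) normp by (simp add: \<gamma>_def)
  moreover have "\<forall>\<^sub>F t in nhds 0. \<gamma> t \<in> sphere 0 r \<inter> U"
  proof -
    have "isCont \<gamma> 0"
      using \<open>(\<gamma> has_vector_derivative v) (at 0)\<close> by (rule has_vector_derivative_continuous)
    then have "(\<gamma> \<longlongrightarrow> \<gamma> 0) (nhds 0)"
      unfolding isCont_def tendsto_at_iff_tendsto_nhds .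
    then have "\<forall>\<^sub>F t in nhds 0. \<gamma> t \<in> U"
      by (rule topological_tendstoD) (simp_all add: U \<open>\<gamma> 0 = p\<close>)
    then show ?thesis
      by (rule eventually_mono) (use p(2) nz in \<open>simp add: \<gamma>_def\<close>)
  qed
  ultimately show "v \<in> tangent_space (sphere 0 r \<inter> U) p"
    by (auto simp: tangent_space_def)
qed

text \<open>The span of \<open>S\<close> is proper iff \<open>S\<close> lies in a hyperplane through
  0; \<open>x\<close> is a normal vector. For the rank, \<open>x\<close> becomes the coefficient
  pair of a linear relation.\<close>

lemma dim_lt_DIM_iff:
  fixes S :: "'a::euclidean_space set"
  shows "dim S < DIM('a) \<longleftrightarrow> (\<exists>x. x \<noteq> 0 \<and> (\<forall>y\<in>S. x \<bullet> y = 0))"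
proof
  assume "dim S < DIM('a)"
  then show "\<exists>x. x \<noteq> 0 \<and> (\<forall>y\<in>S. x \<bullet> y = 0)"
    by (metis orthogonal_to_subspace_exists orthogonal_def span_base)
next
  assume "\<exists>x. x \<noteq> 0 \<and> (\<forall>y\<in>S. x \<bullet> y = 0)"
  then obtain x where x: "x \<noteq> 0" "S \<subseteq> {y. x \<bullet> y = 0}" by auto
  then have "dim S \<le> DIM('a) - 1"
    using dim_subset dim_hyperplane by metis
  then show "dim S < DIM('a)"
    using DIM_positive [where 'a = 'a] by linarith
qed

lemma of_real_of_rat: "of_real (of_rat q) = (of_rat q :: 'a::{real_field,field_char_0})"
  by (cases q) (simp add: of_rat_rat)

section \<open>The differential of the Milnor product map\<close>

text \<open>Locally \<open>h / |h|\<close> is \<open>exp (\<i> arg h)\<close>, and the derivative of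
  \<open>arg h\<close> is the imaginary part of the logarithmic derivative \<open>h' / h\<close>.
  The vector \<open>\<i> * sgn (h p)\<close> is the unit tangent of the circle.\<close>

lemma has_derivative_unit_direction:
  fixes h :: "'a::real_normed_vector \<Rightarrow> complex"
  assumes h: "(h has_derivative h') (at p)" and nz: "h p \<noteq> 0"
  shows "((\<lambda>z. h z / of_real (cmod (h z))) has_derivative
    (\<lambda>v. Im (h' v / h p) *\<^sub>R (\<i> * sgn (h p)))) (at p)"
proof -
  have cm: "((\<lambda>z. complex_of_real (cmod (h z))) has_derivative (\<lambda>v. complex_of_real (h' v \<bullet> sgn (h p)))) (at p)"
    using has_derivative_compose [OF h has_derivative_norm [OF nz]]
    by (intro has_derivative_of_real) (simp add: inner_commute)
  have "((\<lambda>z. h z / of_real (cmod (h z))) has_derivative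
    (\<lambda>v. (h' v * of_real (cmod (h p)) - h p * of_real (h' v \<bullet> sgn (h p))) /
       (of_real (cmod (h p)) * of_real (cmod (h p))))) (at p)"
    using nz by (intro has_derivative_divide' h cm) simp
  moreover have "(k * of_real (cmod w) - w * of_real (k \<bullet> sgn w)) / (of_real (cmod w) * of_real (cmod w)) =
      Im (k / w) *\<^sub>R (\<i> * sgn w)" if "w \<noteq> 0" for k w
  proof -
    \<comment> \<open>In terms of the quotient \<open>q\<close>, the derivative of the modulus
      cancels \<open>Re q\<close> and only \<open>Im q\<close> survives.\<close>
    define q where "q = k / w"
    have k: "k = q * w" using that by (simp add: q_def)
    have "k \<bullet> sgn w = Re q * cmod w"
    proof -
      have "k \<bullet> w = Re q * (cmod w)\<^sup>2"
        unfolding k cmod_power2 by (simp add: inner_complex_def algebra_simps power2_eq_square)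
      then show ?thesis
        using that by (simp add: sgn_div_norm power2_eq_square field_simps)
    qed
    moreover have "q - of_real (Re q) = \<i> * of_real (Im q)"
      by (simp add: complex_eq_iff)
    then have "k - w * of_real (Re q) = \<i> * of_real (Im q) * w"
      unfolding k by (metis left_diff_distrib mult.commute)
    ultimately have "k * of_real (cmod w) - w * of_real (k \<bullet> sgn w) =
        of_real (cmod w) * (\<i> * of_real (Im q) * w)"
      by (simp add: algebra_simps)
    then show ?thesis
      using that unfolding q_def [symmetric] by (simp add: sgn_eq scaleR_conv_of_real)
  qed
  ultimately show ?thesis
    using nz by simp
qed

text \<open>The map \<open>?J\<close> identifies the real plane with the tangent plane of the torus,
  so the rank is the dimension of the image of \<open>?A\<close>. It is below 2 iff some nonzero
  \<open>(a, b)\<close> is orthogonal to that image.\<close>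

lemma milnor_singular_point_iff:
  fixes f g :: "'n::finite cpoly"
  assumes "0 < \<epsilon>" and p: "p \<in> sphere 0 \<epsilon> - milnor_link f g \<epsilon>"
  shows "milnor_singular_point f g \<epsilon> p \<longleftrightarrow>
    (\<exists>a b. (a, b) \<noteq> (0, 0) \<and> (\<forall>v. p \<bullet> v = 0 \<longrightarrow>
       a * Im (cpoly_diff f p v / cpoly_eval f p) + b * Im (cpoly_diff g p v / cpoly_eval g p) = 0))"
proof -
  let ?M = "sphere 0 \<epsilon> - milnor_link f g \<epsilon>" and ?T = "{v. p \<bullet> v = 0}"
  let ?A = "\<lambda>v. (Im (cpoly_diff f p v / cpoly_eval f p), Im (cpoly_diff g p v / cpoly_eval g p))"
  let ?J = "\<lambda>(x, y). (x *\<^sub>R (\<i> * sgn (cpoly_eval f p)), y *\<^sub>R (\<i> * sgn (cpoly_eval g p)))"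
  have nz: "cpoly_eval f p \<noteq> 0" "cpoly_eval g p \<noteq> 0"
    using p by (auto simp: milnor_link_def)
  have cont: "continuous_on UNIV (cpoly_eval h)" for h :: "'n cpoly"
    using cpoly_eval_has_derivative has_derivative_continuous
    by (intro continuous_at_imp_continuous_on) blast
  have "open {z. cpoly_eval f z * cpoly_eval g z \<noteq> 0}"
    by (intro open_Collect_neq continuous_intros cont)
  moreover have "?M = sphere 0 \<epsilon> \<inter> {z. cpoly_eval f z * cpoly_eval g z \<noteq> 0}"
    by (auto simp: milnor_link_def)
  ultimately have tangent: "tangent_space ?M p = ?T"
    using tangent_space_sphere_Int_open [of p \<epsilon>] assms(1) p by fastforce
  have "(milnor_product_map f g has_derivative (\<lambda>v. ?J (?A v))) (at p)"
    unfolding milnor_product_map_def [abs_def] prod.case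
    by (intro has_derivative_Pair has_derivative_unit_direction cpoly_eval_has_derivative nz)
  from differential_rank_eq [OF has_derivative_at_withinI [OF this], of ?M]
  have "differential_rank ?M (milnor_product_map f g) p = dim ((\<lambda>v. ?J (?A v)) ` ?T)"
    by (simp only: tangent)
  also have "\<dots> = dim (?J ` ?A ` ?T)"
    by (simp add: image_image)
  also have "\<dots> = dim (?A ` ?T)"
  proof (rule dim_image_eq)
    show "linear ?J"
      by (rule linearI) (auto simp: algebra_simps)
    show "inj_on ?J (span (?A ` ?T))"
      using nz by (auto simp: inj_on_def sgn_zero_iff)
  qed
  finally have "milnor_singular_point f g \<epsilon> p \<longleftrightarrow> dim (?A ` ?T) < DIM(real \<times> real)"
    by (simp add: milnor_singular_point_def numeral_2_eq_2)
  then show ?thesis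
    unfolding dim_lt_DIM_iff by (simp add: zero_prod_def)
qed

section \<open>Singular points and the minors of the differentials\<close>

theorem corollary3p6:
  fixes f g :: "'n::finite cpoly"
    and wf wg :: "'n \<Rightarrow> rat"
    and s :: rat
  assumes "CARD('n) \<ge> 2"
    and "weighted_homogeneous wf f"
    and "weighted_homogeneous wg g"
    and "s > 0"
    and "\<And>j. wg j = s * wf j"
  shows "\<exists>\<epsilon>\<^sub>0 > (0::real). \<forall>\<epsilon>. 0 < \<epsilon> \<and> \<epsilon> \<le> \<epsilon>\<^sub>0 \<longrightarrow>
           (\<forall>p \<in> sphere 0 \<epsilon> - milnor_link f g \<epsilon>.
              milnor_singular_point f g \<epsilon> p \<longleftrightarrow>
              (\<forall>j k. cpoly_eval (cpoly_partial j f) p * cpoly_eval (cpoly_partial k g) p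
                   - cpoly_eval (cpoly_partial k f) p * cpoly_eval (cpoly_partial j g) p = 0))"
\<comment> \<open>Any positive bound serves as the witness; 1 is a convenient choice.\<close>
proof (intro exI [of _ 1] conjI allI impI ballI)
  show "(0::real) < 1" by simp
next
  fix \<epsilon> :: real and p
  assume \<epsilon>: "0 < \<epsilon> \<and> \<epsilon> \<le> 1" and p: "p \<in> sphere 0 \<epsilon> - milnor_link f g \<epsilon>"
  let ?f = "cpoly_eval f p" and ?g = "cpoly_eval g p"
  let ?df = "\<lambda>j. cpoly_eval (cpoly_partial j f) p" and ?dg = "\<lambda>j. cpoly_eval (cpoly_partial j g) p"
  let ?A = "\<lambda>v. cpoly_diff f p v / ?f" and ?B = "\<lambda>v. cpoly_diff g p v / ?g"
  define \<sigma> where "\<sigma> = (of_rat s :: real)"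
  define E where "E = (\<chi> j. p $ j / of_rat (wf j))"
  have nz: "?f \<noteq> 0" "?g \<noteq> 0" and p0: "p \<noteq> 0"
    using p \<epsilon> by (auto simp: milnor_link_def)
  have w: "0 < wf j" for j
    using assms(2) by (simp add: weighted_homogeneous_def)
  have \<sigma>: "0 < \<sigma>" "of_rat s = complex_of_real \<sigma>"
    using assms(4) by (simp_all add: \<sigma>_def of_real_of_rat)
  have AE: "?A E = 1"
    using weighted_homogeneous_euler [OF assms(2), of p] nz
    by (simp add: cpoly_diff_def E_def)
  have BE: "?B E = of_real \<sigma>"
  proof -
    \<comment> \<open>\<open>E\<close> is built from the weights of \<open>f\<close>; since
      \<open>1 / wf j = s / wg j\<close>, the Euler identity of \<open>g\<close> applies with the
      extra factor \<open>s\<close>.\<close>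
    have "cpoly_diff g p E = of_rat s * (\<Sum>j\<in>UNIV. p $ j / of_rat (wg j) * ?dg j)"
      using assms(4) by (simp add: cpoly_diff_def E_def sum_distrib_left assms(5) of_rat_mult)
    then show ?thesis
      using weighted_homogeneous_euler [OF assms(3), of p] nz \<sigma>(2) by simp
  qed
  \<comment> \<open>Proportionality of the logarithmic differentials with the fixed factor
    \<open>\<sigma>\<close> is the intermediate condition linking singularity to the minors.\<close>
  have "milnor_singular_point f g \<epsilon> p \<longleftrightarrow> (\<forall>v. ?B v = of_real \<sigma> * ?A v)"
  proof
    assume "milnor_singular_point f g \<epsilon> p"
    then obtain a b where ab: "(a, b) \<noteq> (0, 0)"
      and tan: "\<And>v. p \<bullet> v = 0 \<Longrightarrow> a * Im (?A v) + b * Im (?B v) = 0"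
      using milnor_singular_point_iff [OF _ p] \<epsilon> by blast
    define L where "L v = of_real a * ?A v + of_real b * ?B v" for v
    have lin: "linear L"
      by (rule linearI) (simp_all add: L_def scaleR_conv_of_real [where 'a = complex] algebra_simps add_divide_distrib
          linear_add [OF linear_cpoly_diff] linear_scale [OF linear_cpoly_diff])
    \<comment> \<open>Taking \<open>c = \<i>\<close> exchanges real and imaginary parts: this is
      used to evaluate at \<open>\<i> E\<close>, and later to pass from \<open>Im L = 0\<close> to
      \<open>L = 0\<close>.\<close>
    have L_mult: "L (\<chi> j. c * v $ j) = c * L v" for c v
      by (simp add: L_def cpoly_diff_mult_left algebra_simps)
    have L_tan: "Im (L v) = 0" if "p \<bullet> v = 0" for v
      using tan [OF that] by (simp add: L_def del: times_divide_eq_right)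
    have LE: "L E = of_real (a + b * \<sigma>)"
      by (simp add: L_def AE BE del: times_divide_eq_right)
    \<comment> \<open>Each \<open>E $ j\<close> is a real multiple of \<open>p $ j\<close>, so
      multiplying it by \<open>\<i>\<close> makes it real-orthogonal to
      \<open>p $ j\<close>.\<close>
    have "p \<bullet> (\<chi> j. \<i> * E $ j) = 0"
      unfolding inner_vec_def
    proof (intro sum.neutral ballI)
      fix j
      have "E $ j = of_real (1 / of_rat (wf j)) * p $ j"
        by (simp add: E_def of_real_of_rat)
      then show "p $ j \<bullet> (\<chi> j. \<i> * E $ j) $ j = 0"
        by (simp add: inner_complex_def)
    qed
    then have "Im (\<i> * L E) = 0"
      using L_tan L_mult by metis
    then have sum0: "a + b * \<sigma> = 0"
      by (simp add: LE)
    have inner_eq: "p $ j \<bullet> E $ j = (p $ j \<bullet> p $ j) / of_rat (wf j)" for j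
    proof -
      have "E $ j = (1 / of_rat (wf j)) *\<^sub>R p $ j"
        by (simp add: E_def scaleR_conv_of_real of_real_of_rat)
      then show ?thesis by simp
    qed
    obtain j where "p $ j \<noteq> 0"
      using p0 by (auto simp: vec_eq_iff)
    have pE: "0 < p \<bullet> E"
      unfolding inner_vec_def
    proof (rule sum_pos2)
      show "0 < p $ j \<bullet> E $ j"
        using w [of j] \<open>p $ j \<noteq> 0\<close> by (simp add: inner_eq)
      show "0 \<le> p $ i \<bullet> E $ i" for i
        using w [of i] by (simp add: inner_eq)
    qed simp_all
    have Im0: "Im (L v) = 0" for v
    proof -
      \<comment> \<open>This \<open>c\<close> makes \<open>v - c E\<close> tangent to the sphere;
        subtracting \<open>c E\<close> does not change \<open>L v\<close>, since
        \<open>L E = 0\<close> by \<open>sum0\<close>.\<close>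
      define c where "c = (p \<bullet> v) / (p \<bullet> E)"
      have "p \<bullet> (v - c *\<^sub>R E) = 0"
        using pE by (simp add: c_def inner_diff_right)
      moreover have "L (v - c *\<^sub>R E) = L v - c *\<^sub>R L E"
        by (simp add: linear_diff [OF lin] linear_scale [OF lin])
      ultimately show ?thesis
        using L_tan [of "v - c *\<^sub>R E"] by (simp add: LE sum0)
    qed
    have L0: "L v = 0" for v
    proof -
      have "Im (\<i> * L v) = 0"
        using Im0 L_mult by metis
      then show ?thesis
        using Im0 by (simp add: complex_eq_iff)
    qed
    \<comment> \<open>If \<open>b\<close> were 0, \<open>sum0\<close> would force
      \<open>a = 0\<close> as well.\<close>
    have "b \<noteq> 0"
      using ab sum0 by auto
    moreover have "L v = of_real b * (?B v - of_real \<sigma> * ?A v)" for v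
    proof -
      have "a = - b * \<sigma>"
        using sum0 by simp
      then show ?thesis
        by (simp add: L_def algebra_simps)
    qed
    ultimately show "\<forall>v. ?B v = of_real \<sigma> * ?A v"
      using L0 by simp
  next
    assume "\<forall>v. ?B v = of_real \<sigma> * ?A v"
    then have "\<forall>v. - \<sigma> * Im (?A v) + 1 * Im (?B v) = 0"
      by (simp del: times_divide_eq_right)
    moreover have "(- \<sigma>, 1 :: real) \<noteq> (0, 0)"
      by simp
    ultimately show "milnor_singular_point f g \<epsilon> p"
      using milnor_singular_point_iff [OF _ p] \<epsilon> by blast
  qed
  also have "\<dots> \<longleftrightarrow> (\<forall>j k. ?df j * ?dg k - ?df k * ?dg j = 0)"
  proof
    assume B: "\<forall>v. ?B v = of_real \<sigma> * ?A v"
    have "?dg j = of_real \<sigma> * ?g / ?f * ?df j" for j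
      using B [rule_format, of "axis j 1"] nz by (simp add: cpoly_diff_axis field_simps)
    then show "\<forall>j k. ?df j * ?dg k - ?df k * ?dg j = 0"
      by simp
  next
    assume minors: "\<forall>j k. ?df j * ?dg k - ?df k * ?dg j = 0"
    \<comment> \<open>Contracting the vanishing minors with \<open>E\<close> in one index and
      \<open>v\<close> in the other gives this identity; the values at \<open>E\<close> then fix the
      proportionality factor.\<close>
    have "cpoly_diff f p E * cpoly_diff g p v = cpoly_diff f p v * cpoly_diff g p E" for v
    proof -
      have "E $ j * ?df j * (v $ k * ?dg k) = v $ k * ?df k * (E $ j * ?dg j)" for j k
        using minors [rule_format, of j k] by algebra
      then show ?thesis
        unfolding cpoly_diff_def sum_product by (subst sum.swap) (simp only:)
    qed
    moreover have "cpoly_diff f p E = ?f" "cpoly_diff g p E = of_real \<sigma> * ?g"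
      using AE BE nz by (simp_all add: field_simps)
    ultimately have "?f * cpoly_diff g p v = cpoly_diff f p v * (of_real \<sigma> * ?g)" for v
      by metis
    then show "\<forall>v. ?B v = of_real \<sigma> * ?A v"
      using nz by (simp add: field_simps)
  qed
  finally show "milnor_singular_point f g \<epsilon> p \<longleftrightarrow> (\<forall>j k. ?df j * ?dg k - ?df k * ?dg j = 0)" .
qed

end
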